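(* Consider the semi-discrete Lagrangian HTC scheme described in the context with vanishing source in the equation for the distortion field, i.e. $\tau_1\to\infty$ (the right-hand side $-\frac1{\theta_1}\boldsymbol\Gamma_c$ is set to $0$). Suppose the initial data for the distortion field are curl-free, given by $\mathbf A_c(0)=\nabla_c^p\boldsymbol\xi_p$, i.e. $A_c^{ik}(0)=\frac1{|\omega_c(0)|}\sum_{p\in\mathcal P(c)}l_{pc}n_{pc}^k\,\xi_p^i$ with corner normals taken at $t=0$, where $\boldsymbol\xi_p=\mathbf x_p(0)$ are the Lagrangian node coordinates; hence $\nabla_p^c\times\mathbf A_c(0)=0$. Assume exact time integration, i.e. consider an exact (differentiable in time) solution of the semi-discrete system. Then the scheme preserves the curl of the rows of $\mathbf A_c$ exactly: for all times $t$ and every interior node $p$ (every node, in the periodic case), $$\nabla_p^c\times\mathbf A_c(t)=0,$$ i.e. $-\frac1{|\omega_p|}\sum_{c\in\mathcal C(p)}l_{pc}\big(n_{pc}^1A_c^{i2}-n_{pc}^2A_c^{i1}\big)=0$ for each row $i$.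
   Context: **Mesh.** $\Omega(t)\subset\mathbb R^2$ is covered by a conforming mesh of non-overlapping non-degenerate triangles $\omega_c(t)$ of area $|\omega_c|$, with fixed connectivity and moving nodes. $\mathcal P(c)$ is the set of vertices of $\omega_c$, $\mathcal C(p)$ the set of cells sharing node $p$. For $p\in\mathcal P(c)$, with $(p,p^-,p^+)$ the vertices of $\omega_c$ in counter-clockwise order and $\mathbf x_p=(x_p,y_p)$, the corner normal is $l_{pc}\mathbf n_{pc}=\frac12(y_{p^-}-y_{p^+},\,x_{p^+}-x_{p^-})$, where $\mathbf n_{pc}=(n_{pc}^1,n_{pc}^2)$ is a unit vector and $l_{pc}>0$; hence $\sum_{p\in\mathcal P(c)}l_{pc}\mathbf n_{pc}=\mathbf 0$. The sub-cell $\omega_{pc}$ is the quadrilateral with vertices $\mathbf x_p$, the barycenter of $\omega_c$ and the midpoints of the two edges of $\omega_c$ at $p$; $\omega_p=\bigcup_{c\in\mathcal C(p)}\omega_{pc}$ is the dual cell, of area $|\omega_p|$. A node is interior if the cells around it form a closed fan. Nodes move by $\frac{d\mathbf x_p}{dt}=\mathbf v_p$, $\mathbf x_p(0)=\boldsymbol\xi_p$. Vectors have two components and tensors are $2\times2$. **Discrete operators.** For nodal fields $\phi_p$: $\nabla_c^p\phi_p=\frac1{|\omega_c|}\sum_{p\in\mathcal P(c)}l_{pc}\mathbf n_{pc}\phi_p$. For cell vector fields: $\nabla_p^c\times\mathbf J_c=-\frac1{|\omega_p|}\sum_{c\in\mathcal C(p)}l_{pc}\mathbf n_{pc}\times\mathbf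 J_c$ with $\mathbf a\times\mathbf b=a_1b_2-a_2b_1$; for a tensor it is applied to each row. **State and energy.** Each cell carries specific volume $\tau_c=1/\rho_c>0$, velocity $\mathbf v_c$, specific entropy $S_c$, distortion $\mathbf A_c$, thermal impulse $\mathbf J_c$. The mass $m_c=\rho_c|\omega_c|$ is constant in time. The specific total energy is $E=E_1(\tau,S)+\frac12|\mathbf v|^2+\frac14c_s^2\,\mathring G_{ij}\mathring G_{ij}+\frac12c_h^2|\mathbf J|^2$, with $E_1$ a given smooth convex function, $\mathbf G=\mathbf A^T\mathbf A$, $\mathring G_{ij}=G_{ij}-\frac13G_{mm}\delta_{ij}$ and constants $c_s,c_h$. Dual variables: $p=-\partial E/\partial\tau$, $T=\partial E/\partial S$ (assumed $>0$), $\boldsymbol\Gamma=\partial E/\partial\mathbf A$, $\boldsymbol\beta=\partial E/\partial\mathbf J$; stress $\boldsymbol\sigma=\rho\mathbf A^T\boldsymbol\Gamma+\rho\,\mathbf J\otimes\boldsymbol\beta$. A subscript $c$ means evaluation at the state of cell $c$. $\theta_1=\theta_1(\tau_1)>0$, $\theta_2=\theta_2(\tau_2)>0$ are given functions of relaxation times $\tau_1,\tau_2>0$; vanishing source $\tau_1\to\infty$ means that all terms with $1/\theta_1$ are dropped. **Scheme** (summation over repeated component indices $i,j,k,l$): $$m_c\frac{d\tau_c}{dt}-\sum_{p\in\mathcal P(c)}l_{pc}\mathbf n_{pc}\cdot(\mathbf v_p-\mathbf v_c)=0,$$ $$m_c\frac{d v_c^i}{dt}+\sum_{p\in\mathcal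 P(c)}\Big(l_{pc}n_{pc}^i(p_p-p_c)+l_{pc}n_{pc}^k(\sigma_p^{ik}-\sigma_c^{ik})\Big)+\sum_{p\in\mathcal P(c)}l_{pc}(\alpha_p+\epsilon_p)(v_c^i-v_p^i)=0,$$ $$m_c\frac{dS_c}{dt}+\sum_{p\in\mathcal P(c)}l_{pc}\mathbf n_{pc}\cdot(\rho_p\boldsymbol\beta_p-\rho_c\boldsymbol\beta_c)=\Pi_c+\pi_c,$$ $$m_c\frac{dA_c^{ik}}{dt}+\rho_cA_c^{il}\sum_{p\in\mathcal P(c)}l_{pc}n_{pc}^k(v_p^l-v_c^l)=-\frac1{\theta_1}\Gamma_c^{ik},$$ $$m_c\frac{dJ_c^i}{dt}+\rho_cJ_c^l\sum_{p\in\mathcal P(c)}l_{pc}n_{pc}^i(v_p^l-v_c^l)+\rho_c\sum_{p\in\mathcal P(c)}l_{pc}n_{pc}^i(T_p-T_c)+\rho_c\sum_{p\in\mathcal P(c)}l_{pc}n_{pc}^i(\alpha_p+\epsilon_p)D_p=-\frac1{\theta_2}\beta_c^i,$$ where $D_p=\sum_{c\in\mathcal C(p)}l_{pc}\mathbf n_{pc}\cdot\rho_c\boldsymbol\beta_c$, $\epsilon_p\ge0$ is a given numerical viscosity, and each nodal value is the average $q_p=\big(\sum_{c\in\mathcal C(p)}l_{pc}q_c\big)/\sum_{c\in\mathcal C(p)}l_{pc}$ for $q\in\{\mathbf v,p,\rho,T,\boldsymbol\sigma,\boldsymbol\beta\}$. Entropy production: $\pi_c=\frac{\boldsymbol\Gamma_c:\boldsymbol\Gamma_c}{T_c\theta_1}+\frac{\boldsymbol\beta_c\cdot\boldsymbol\beta_c}{T_c\theta_2}$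 and $\Pi_c=\sum_{p\in\mathcal P(c)}\frac{|\omega_{pc}|}{|\omega_p|}\frac{\Pi_p}{T_c}$ with $\Pi_p=\epsilon_p\delta_p$, $\delta_p=\sum_{c\in\mathcal C(p)}l_{pc}|\mathbf v_c-\mathbf v_p|^2+D_p^2$. The correction factor is $\alpha_p=\nu_p/\delta_p$ if $\delta_p\ne0$ and $\alpha_p=0$ if $\delta_p=0$, with $$\nu_p=\sum_{c\in\mathcal C(p)}l_{pc}n_{pc}^k\Big(p_cv_c^k-p_cv_p^k-p_pv_c^k+\sigma_c^{ik}v_c^i-\sigma_c^{ik}v_p^i-\sigma_p^{ik}v_c^i+T_c\rho_c\beta_c^k-T_c\rho_p\beta_p^k-T_p\rho_c\beta_c^k\Big).$$ *)

theory Defs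
  imports "HOL-Analysis.Analysis"
begin

section \<open>Mesh and corner geometry\<close>

text \<open>Connectivity of a triangular mesh. For a vertex p of the cell c, the term ccw M c p is the
  vertex following p in counter-clockwise order, so (p, ccw p, ccw (ccw p)) is (p, p^-, p^+).
  The set of cells may be infinite: a periodic mesh is represented by its lift to the whole plane
  (see \<open>periodic_flow\<close> below), so that node positions and all corner vectors are single-valued.\<close>

record ('p, 'c) mesh =
  cells :: "'c set"
  verts :: "'c \<Rightarrow> 'p set"
  ccw :: "'c \<Rightarrow> 'p \<Rightarrow> 'p"

definition nodes :: "('p, 'c) mesh \<Rightarrow> 'p set" where
  "nodes M = (\<Union>c\<in>cells M. verts M c)"

definition cells_at :: "('p, 'c) mesh \<Rightarrow> 'p \<Rightarrow> 'c set" where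
  "cells_at M p = {c \<in> cells M. p \<in> verts M c}"

definition pminus :: "('p, 'c) mesh \<Rightarrow> 'c \<Rightarrow> 'p \<Rightarrow> 'p" where
  "pminus M c p = ccw M c p"

definition pplus :: "('p, 'c) mesh \<Rightarrow> 'c \<Rightarrow> 'p \<Rightarrow> 'p" where
  "pplus M c p = ccw M c (ccw M c p)"

definition cross2 :: "real^2 \<Rightarrow> real^2 \<Rightarrow> real" where
  "cross2 a b = a $ 1 * b $ 2 - a $ 2 * b $ 1"

definition triangle :: "('p, 'c) mesh \<Rightarrow> ('p \<Rightarrow> real^2) \<Rightarrow> 'c \<Rightarrow> (real^2) set" where
  "triangle M x c = convex hull (x ` verts M c)"

definition area :: "('p, 'c) mesh \<Rightarrow> ('p \<Rightarrow> real^2) \<Rightarrow> 'c \<Rightarrow> real" where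
  "area M x c = measure lborel (triangle M x c)"

definition connectivity :: "('p, 'c) mesh \<Rightarrow> bool" where
  "connectivity M \<longleftrightarrow>
     (\<forall>c\<in>cells M. card (verts M c) = 3 \<and>
        (\<forall>p\<in>verts M c. verts M c = {p, pminus M c p, pplus M c p}))"

text \<open>In \<open>conforming_mesh\<close> the strict inequality expresses both non-degeneracy and the
  counter-clockwise orientation; the last condition is local finiteness, which is automatic for a
  finite mesh.\<close>

definition conforming_mesh :: "('p, 'c) mesh \<Rightarrow> ('p \<Rightarrow> real^2) \<Rightarrow> bool" where
  "conforming_mesh M x \<longleftrightarrow>
     connectivity M \<and>
     (\<forall>c\<in>cells M. \<forall>p\<in>verts M c.
        0 < cross2 (x (pminus M c p) - x p) (x (pplus M c p) - x p)) \<and>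
     (\<forall>c\<in>cells M. \<forall>d\<in>cells M. c \<noteq> d \<longrightarrow>
        interior (triangle M x c) \<inter> interior (triangle M x d) = {} \<and>
        triangle M x c \<inter> triangle M x d = convex hull (x ` (verts M c \<inter> verts M d))) \<and>
     (\<forall>K. bounded K \<longrightarrow> finite {c \<in> cells M. triangle M x c \<inter> K \<noteq> {}})"

text \<open>The closed fan is enumerated counter-clockwise: consecutive cells share the edge
  from p to the p^+ of the first one.\<close>

definition interior_node :: "('p, 'c) mesh \<Rightarrow> 'p \<Rightarrow> bool" where
  "interior_node M p \<longleftrightarrow>
     (\<exists>cs. cs \<noteq> [] \<and> distinct cs \<and> set cs = cells_at M p \<and>
        (\<forall>i<length cs. pplus M (cs ! i) p = pminus M (cs ! (Suc i mod length cs)) p))"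

text \<open>The vector l_pc n_pc; since n_pc is a unit vector and l_pc > 0, l_pc is its norm.\<close>

definition corner :: "('p, 'c) mesh \<Rightarrow> ('p \<Rightarrow> real^2) \<Rightarrow> 'p \<Rightarrow> 'c \<Rightarrow> real^2" where
  "corner M x p c = (1/2) *\<^sub>R
     vector [x (pminus M c p) $ 2 - x (pplus M c p) $ 2,
             x (pplus M c p) $ 1 - x (pminus M c p) $ 1]"

definition corner_len :: "('p, 'c) mesh \<Rightarrow> ('p \<Rightarrow> real^2) \<Rightarrow> 'p \<Rightarrow> 'c \<Rightarrow> real" where
  "corner_len M x p c = norm (corner M x p c)"

definition barycenter :: "('p, 'c) mesh \<Rightarrow> ('p \<Rightarrow> real^2) \<Rightarrow> 'c \<Rightarrow> real^2" where
  "barycenter M x c = (1/3) *\<^sub>R (\<Sum>q\<in>verts M c. x q)"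

text \<open>The quadrilateral is convex, hence the convex hull of its vertices.\<close>

definition subcell :: "('p, 'c) mesh \<Rightarrow> ('p \<Rightarrow> real^2) \<Rightarrow> 'p \<Rightarrow> 'c \<Rightarrow> (real^2) set" where
  "subcell M x p c = convex hull
     {x p, midpoint (x p) (x (pminus M c p)), barycenter M x c, midpoint (x p) (x (pplus M c p))}"

definition subcell_area :: "('p, 'c) mesh \<Rightarrow> ('p \<Rightarrow> real^2) \<Rightarrow> 'p \<Rightarrow> 'c \<Rightarrow> real" where
  "subcell_area M x p c = measure lborel (subcell M x p c)"

definition dual_area :: "('p, 'c) mesh \<Rightarrow> ('p \<Rightarrow> real^2) \<Rightarrow> 'p \<Rightarrow> real" where
  "dual_area M x p = measure lborel (\<Union>c\<in>cells_at M p. subcell M x p c)"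

section \<open>Discrete operators\<close>

definition disc_grad :: "('p, 'c) mesh \<Rightarrow> ('p \<Rightarrow> real^2) \<Rightarrow> 'c \<Rightarrow> ('p \<Rightarrow> real) \<Rightarrow> real^2" where
  "disc_grad M x c \<phi> = (1 / area M x c) *\<^sub>R (\<Sum>p\<in>verts M c. \<phi> p *\<^sub>R corner M x p c)"

definition disc_grad_vec ::
  "('p, 'c) mesh \<Rightarrow> ('p \<Rightarrow> real^2) \<Rightarrow> 'c \<Rightarrow> ('p \<Rightarrow> real^2) \<Rightarrow> real^2^2" where
  "disc_grad_vec M x c \<xi> = (\<chi> i. disc_grad M x c (\<lambda>p. \<xi> p $ i))"

definition disc_curl :: "('p, 'c) mesh \<Rightarrow> ('p \<Rightarrow> real^2) \<Rightarrow> 'p \<Rightarrow> ('c \<Rightarrow> real^2) \<Rightarrow> real" where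
  "disc_curl M x p J =
     - (1 / dual_area M x p) * (\<Sum>c\<in>cells_at M p. cross2 (corner M x p c) (J c))"

definition disc_curl_rows ::
  "('p, 'c) mesh \<Rightarrow> ('p \<Rightarrow> real^2) \<Rightarrow> 'p \<Rightarrow> ('c \<Rightarrow> real^2^2) \<Rightarrow> real^2" where
  "disc_curl_rows M x p A = (\<chi> i. disc_curl M x p (\<lambda>c. A c $ i))"

definition nodal_avg ::
  "('p, 'c) mesh \<Rightarrow> ('p \<Rightarrow> real^2) \<Rightarrow> ('c \<Rightarrow> 'v::real_vector) \<Rightarrow> 'p \<Rightarrow> 'v" where
  "nodal_avg M x q p =
     (1 / (\<Sum>c\<in>cells_at M p. corner_len M x p c)) *\<^sub>R
       (\<Sum>c\<in>cells_at M p. corner_len M x p c *\<^sub>R q c)"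

section \<open>State, energy and dual variables\<close>

record state =
  tau :: real
  vel :: "real^2"
  ent :: real
  dstn :: "real^2^2"
  imp :: "real^2"

text \<open>Material data; \<open>theta2\<close> is a function of the relaxation time \<open>tau2\<close>.\<close>

record material =
  E1 :: "real \<Rightarrow> real \<Rightarrow> real"
  cs :: real
  ch :: real
  theta2 :: "real \<Rightarrow> real"
  tau2 :: real

text \<open>Infinite differentiability of a function of two variables on an open set: D a b is the partial
  derivative of order a in the first and b in the second variable.\<close>

definition smooth2_on :: "(real \<times> real) set \<Rightarrow> (real \<Rightarrow> real \<Rightarrow> real) \<Rightarrow> bool" where
  "smooth2_on U f \<longleftrightarrow>
     (\<exists>D :: nat \<Rightarrow> nat \<Rightarrow> real \<times> real \<Rightarrow> real.
        (\<forall>z\<in>U. D 0 0 z = f (fst z) (snd z)) \<and>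
        (\<forall>a b. \<forall>z\<in>U.
           (D a b has_derivative (\<lambda>h. fst h * D (Suc a) b z + snd h * D a (Suc b) z)) (at z)))"

definition admissible_material :: "material \<Rightarrow> bool" where
  "admissible_material W \<longleftrightarrow>
     smooth2_on ({0<..} \<times> UNIV) (E1 W) \<and>
     convex_on ({0<..} \<times> UNIV) (\<lambda>z. E1 W (fst z) (snd z)) \<and>
     0 < tau2 W \<and> (\<forall>s>0. 0 < theta2 W s)"

text \<open>The factor 1/3 is that of the three-dimensional deviator although tensors are 2 x 2 here.\<close>

definition Gring :: "real^2^2 \<Rightarrow> real^2^2" where
  "Gring A = transpose A ** A - (1/3 * trace (transpose A ** A)) *\<^sub>R mat 1"

definition energy :: "material \<Rightarrow> state \<Rightarrow> real" where
  "energy W s = E1 W (tau s) (ent s) + 1/2 * (norm (vel s))\<^sup>2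
     + 1/4 * (cs W)\<^sup>2 * (\<Sum>i\<in>UNIV. \<Sum>j\<in>UNIV. Gring (dstn s) $ i $ j * Gring (dstn s) $ i $ j)
     + 1/2 * (ch W)\<^sup>2 * (norm (imp s))\<^sup>2"

definition dens :: "state \<Rightarrow> real" where
  "dens s = 1 / tau s"

definition press :: "material \<Rightarrow> state \<Rightarrow> real" where
  "press W s = - deriv (\<lambda>a. energy W (s\<lparr>tau := a\<rparr>)) (tau s)"

definition temp :: "material \<Rightarrow> state \<Rightarrow> real" where
  "temp W s = deriv (\<lambda>a. energy W (s\<lparr>ent := a\<rparr>)) (ent s)"

definition Gam :: "material \<Rightarrow> state \<Rightarrow> real^2^2" where
  "Gam W s = (\<chi> i k. deriv
     (\<lambda>a. energy W (s\<lparr>dstn := (\<chi> m n. if m = i \<and> n = k then a else dstn s $ m $ n)\<rparr>))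
     (dstn s $ i $ k))"

definition beta :: "material \<Rightarrow> state \<Rightarrow> real^2" where
  "beta W s = (\<chi> i. deriv
     (\<lambda>a. energy W (s\<lparr>imp := (\<chi> m. if m = i then a else imp s $ m)\<rparr>)) (imp s $ i))"

definition stress :: "material \<Rightarrow> state \<Rightarrow> real^2^2" where
  "stress W s = dens s *\<^sub>R (transpose (dstn s) ** Gam W s)
     + dens s *\<^sub>R (\<chi> i k. imp s $ i * beta W s $ k)"

section \<open>Scheme\<close>

text \<open>Below, x and U are the node positions and cell states at one instant, and e is the numerical
  viscosity. The number r stands for 1/\<theta>_1; the limit of vanishing distortion source is r = 0.\<close>

definition nvel :: "('p, 'c) mesh \<Rightarrow> ('p \<Rightarrow> real^2) \<Rightarrow> ('c \<Rightarrow> state) \<Rightarrow> 'p \<Rightarrow> real^2" where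
  "nvel M x U = nodal_avg M x (\<lambda>c. vel (U c))"

definition npress ::
  "material \<Rightarrow> ('p, 'c) mesh \<Rightarrow> ('p \<Rightarrow> real^2) \<Rightarrow> ('c \<Rightarrow> state) \<Rightarrow> 'p \<Rightarrow> real" where
  "npress W M x U = nodal_avg M x (\<lambda>c. press W (U c))"

definition ndens :: "('p, 'c) mesh \<Rightarrow> ('p \<Rightarrow> real^2) \<Rightarrow> ('c \<Rightarrow> state) \<Rightarrow> 'p \<Rightarrow> real" where
  "ndens M x U = nodal_avg M x (\<lambda>c. dens (U c))"

definition ntemp ::
  "material \<Rightarrow> ('p, 'c) mesh \<Rightarrow> ('p \<Rightarrow> real^2) \<Rightarrow> ('c \<Rightarrow> state) \<Rightarrow> 'p \<Rightarrow> real" where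
  "ntemp W M x U = nodal_avg M x (\<lambda>c. temp W (U c))"

definition nstress ::
  "material \<Rightarrow> ('p, 'c) mesh \<Rightarrow> ('p \<Rightarrow> real^2) \<Rightarrow> ('c \<Rightarrow> state) \<Rightarrow> 'p \<Rightarrow> real^2^2" where
  "nstress W M x U = nodal_avg M x (\<lambda>c. stress W (U c))"

definition nbeta ::
  "material \<Rightarrow> ('p, 'c) mesh \<Rightarrow> ('p \<Rightarrow> real^2) \<Rightarrow> ('c \<Rightarrow> state) \<Rightarrow> 'p \<Rightarrow> real^2" where
  "nbeta W M x U = nodal_avg M x (\<lambda>c. beta W (U c))"

definition Dp ::
  "material \<Rightarrow> ('p, 'c) mesh \<Rightarrow> ('p \<Rightarrow> real^2) \<Rightarrow> ('c \<Rightarrow> state) \<Rightarrow> 'p \<Rightarrow> real" where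
  "Dp W M x U p = (\<Sum>c\<in>cells_at M p. corner M x p c \<bullet> (dens (U c) *\<^sub>R beta W (U c)))"

definition deltap ::
  "material \<Rightarrow> ('p, 'c) mesh \<Rightarrow> ('p \<Rightarrow> real^2) \<Rightarrow> ('c \<Rightarrow> state) \<Rightarrow> 'p \<Rightarrow> real" where
  "deltap W M x U p =
     (\<Sum>c\<in>cells_at M p. corner_len M x p c * (norm (vel (U c) - nvel M x U p))\<^sup>2)
     + (Dp W M x U p)\<^sup>2"

definition nup ::
  "material \<Rightarrow> ('p, 'c) mesh \<Rightarrow> ('p \<Rightarrow> real^2) \<Rightarrow> ('c \<Rightarrow> state) \<Rightarrow> 'p \<Rightarrow> real" where
  "nup W M x U p =
     (\<Sum>c\<in>cells_at M p. \<Sum>k\<in>UNIV. corner M x p c $ k *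
        (press W (U c) * vel (U c) $ k
         - press W (U c) * nvel M x U p $ k
         - npress W M x U p * vel (U c) $ k
         + (\<Sum>i\<in>UNIV. stress W (U c) $ i $ k * vel (U c) $ i
              - stress W (U c) $ i $ k * nvel M x U p $ i
              - nstress W M x U p $ i $ k * vel (U c) $ i)
         + temp W (U c) * dens (U c) * beta W (U c) $ k
         - temp W (U c) * ndens M x U p * nbeta W M x U p $ k
         - ntemp W M x U p * dens (U c) * beta W (U c) $ k))"

definition alphap ::
  "material \<Rightarrow> ('p, 'c) mesh \<Rightarrow> ('p \<Rightarrow> real^2) \<Rightarrow> ('c \<Rightarrow> state) \<Rightarrow> 'p \<Rightarrow> real" where
  "alphap W M x U p =
     (if deltap W M x U p \<noteq> 0 then nup W M x U p / deltap W M x U p else 0)"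

definition prod_visc ::
  "material \<Rightarrow> ('p, 'c) mesh \<Rightarrow> ('p \<Rightarrow> real^2) \<Rightarrow> ('c \<Rightarrow> state) \<Rightarrow> ('p \<Rightarrow> real) \<Rightarrow> 'c \<Rightarrow> real" where
  "prod_visc W M x U e c =
     (\<Sum>p\<in>verts M c. subcell_area M x p c / dual_area M x p
        * (e p * deltap W M x U p / temp W (U c)))"

definition prod_relax :: "material \<Rightarrow> real \<Rightarrow> state \<Rightarrow> real" where
  "prod_relax W r s =
     r * (\<Sum>i\<in>UNIV. \<Sum>k\<in>UNIV. Gam W s $ i $ k * Gam W s $ i $ k) / temp W s
     + (beta W s \<bullet> beta W s) / (temp W s * theta2 W (tau2 W))"

text \<open>The number or vector d in the balance laws is the time derivative of the respective component
  of the state of the cell c, whose mass is m.\<close>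

definition balance_tau ::
  "('p, 'c) mesh \<Rightarrow> ('p \<Rightarrow> real^2) \<Rightarrow> ('c \<Rightarrow> state) \<Rightarrow> 'c \<Rightarrow> real \<Rightarrow> real \<Rightarrow> bool" where
  "balance_tau M x U c m d \<longleftrightarrow>
     m * d - (\<Sum>p\<in>verts M c. corner M x p c \<bullet> (nvel M x U p - vel (U c))) = 0"

definition balance_vel ::
  "material \<Rightarrow> ('p, 'c) mesh \<Rightarrow> ('p \<Rightarrow> real^2) \<Rightarrow> ('c \<Rightarrow> state) \<Rightarrow> ('p \<Rightarrow> real)
    \<Rightarrow> 'c \<Rightarrow> real \<Rightarrow> real^2 \<Rightarrow> bool" where
  "balance_vel W M x U e c m d \<longleftrightarrow>
     (\<forall>i. m * d $ i
        + (\<Sum>p\<in>verts M c. corner M x p c $ i * (npress W M x U p - press W (U c))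
             + (\<Sum>k\<in>UNIV. corner M x p c $ k *
                  (nstress W M x U p $ i $ k - stress W (U c) $ i $ k)))
        + (\<Sum>p\<in>verts M c. corner_len M x p c * (alphap W M x U p + e p)
             * (vel (U c) $ i - nvel M x U p $ i)) = 0)"

definition balance_ent ::
  "material \<Rightarrow> real \<Rightarrow> ('p, 'c) mesh \<Rightarrow> ('p \<Rightarrow> real^2) \<Rightarrow> ('c \<Rightarrow> state) \<Rightarrow> ('p \<Rightarrow> real)
    \<Rightarrow> 'c \<Rightarrow> real \<Rightarrow> real \<Rightarrow> bool" where
  "balance_ent W r M x U e c m d \<longleftrightarrow>
     m * d + (\<Sum>p\<in>verts M c. corner M x p c \<bullet>
                (ndens M x U p *\<^sub>R nbeta W M x U p - dens (U c) *\<^sub>R beta W (U c)))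
       = prod_visc W M x U e c + prod_relax W r (U c)"

definition balance_dstn ::
  "material \<Rightarrow> real \<Rightarrow> ('p, 'c) mesh \<Rightarrow> ('p \<Rightarrow> real^2) \<Rightarrow> ('c \<Rightarrow> state)
    \<Rightarrow> 'c \<Rightarrow> real \<Rightarrow> real^2^2 \<Rightarrow> bool" where
  "balance_dstn W r M x U c m d \<longleftrightarrow>
     (\<forall>i k. m * d $ i $ k
        + (\<Sum>l\<in>UNIV. dens (U c) * dstn (U c) $ i $ l *
             (\<Sum>p\<in>verts M c. corner M x p c $ k * (nvel M x U p $ l - vel (U c) $ l)))
        = - r * Gam W (U c) $ i $ k)"

definition balance_imp ::
  "material \<Rightarrow> ('p, 'c) mesh \<Rightarrow> ('p \<Rightarrow> real^2) \<Rightarrow> ('c \<Rightarrow> state) \<Rightarrow> ('p \<Rightarrow> real)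
    \<Rightarrow> 'c \<Rightarrow> real \<Rightarrow> real^2 \<Rightarrow> bool" where
  "balance_imp W M x U e c m d \<longleftrightarrow>
     (\<forall>i. m * d $ i
        + (\<Sum>l\<in>UNIV. dens (U c) * imp (U c) $ l *
             (\<Sum>p\<in>verts M c. corner M x p c $ i * (nvel M x U p $ l - vel (U c) $ l)))
        + dens (U c) * (\<Sum>p\<in>verts M c. corner M x p c $ i * (ntemp W M x U p - temp W (U c)))
        + dens (U c) * (\<Sum>p\<in>verts M c. corner M x p c $ i
             * (alphap W M x U p + e p) * Dp W M x U p)
        = - (1 / theta2 W (tau2 W)) * beta W (U c) $ i)"

text \<open>A solution on the time set I: x t p, U t c, e t p are node positions, cell states and numerical
  viscosity at time t, and m c is the (time-independent) mass of the cell c.\<close>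

definition htc_solution ::
  "material \<Rightarrow> real \<Rightarrow> ('p, 'c) mesh \<Rightarrow> real set \<Rightarrow> (real \<Rightarrow> 'p \<Rightarrow> real^2)
    \<Rightarrow> (real \<Rightarrow> 'c \<Rightarrow> state) \<Rightarrow> (real \<Rightarrow> 'p \<Rightarrow> real) \<Rightarrow> ('c \<Rightarrow> real) \<Rightarrow> bool" where
  "htc_solution W r M I x U e m \<longleftrightarrow>
     (\<forall>t\<in>I.
        conforming_mesh M (x t) \<and>
        (\<forall>p\<in>nodes M. 0 \<le> e t p \<and>
           ((\<lambda>s. x s p) has_vector_derivative nvel M (x t) (U t) p) (at t within I)) \<and>
        (\<forall>c\<in>cells M.
           0 < tau (U t c) \<and> 0 < temp W (U t c) \<and>
           m c = dens (U t c) * area M (x t) c \<and>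
           (\<exists>d. ((\<lambda>s. tau (U s c)) has_vector_derivative d) (at t within I) \<and>
              balance_tau M (x t) (U t) c (m c) d) \<and>
           (\<exists>d. ((\<lambda>s. vel (U s c)) has_vector_derivative d) (at t within I) \<and>
              balance_vel W M (x t) (U t) (e t) c (m c) d) \<and>
           (\<exists>d. ((\<lambda>s. ent (U s c)) has_vector_derivative d) (at t within I) \<and>
              balance_ent W r M (x t) (U t) (e t) c (m c) d) \<and>
           (\<exists>d. ((\<lambda>s. dstn (U s c)) has_vector_derivative d) (at t within I) \<and>
              balance_dstn W r M (x t) (U t) c (m c) d) \<and>
           (\<exists>d. ((\<lambda>s. imp (U s c)) has_vector_derivative d) (at t within I) \<and>
              balance_imp W M (x t) (U t) (e t) c (m c) d)))"

section \<open>Periodic case\<close>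

text \<open>Invariance of mesh, motion and states under translation by the vector L; f and g are the
  induced permutations of nodes and cells.\<close>

definition translation_symmetry ::
  "('p, 'c) mesh \<Rightarrow> real set \<Rightarrow> (real \<Rightarrow> 'p \<Rightarrow> real^2) \<Rightarrow> (real \<Rightarrow> 'c \<Rightarrow> state)
    \<Rightarrow> (real \<Rightarrow> 'p \<Rightarrow> real) \<Rightarrow> ('c \<Rightarrow> real) \<Rightarrow> real^2 \<Rightarrow> bool" where
  "translation_symmetry M I x U e m L \<longleftrightarrow>
     (\<exists>f g. bij_betw f (nodes M) (nodes M) \<and> bij_betw g (cells M) (cells M) \<and>
        (\<forall>c\<in>cells M. verts M (g c) = f ` verts M c \<and> m (g c) = m c \<and>
           (\<forall>p\<in>verts M c. ccw M (g c) (f p) = f (ccw M c p))) \<and>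
        (\<forall>t\<in>I.
           (\<forall>p\<in>nodes M. x t (f p) = x t p + L \<and> e t (f p) = e t p) \<and>
           (\<forall>c\<in>cells M. U t (g c) = U t c)))"

text \<open>The periodic case: the lifted cells cover the plane, and everything is invariant under the
  lattice generated by two linearly independent vectors. By local finiteness there are then only
  finitely many cells modulo the lattice. That every node is interior is not assumed.\<close>

definition periodic_flow ::
  "('p, 'c) mesh \<Rightarrow> real set \<Rightarrow> (real \<Rightarrow> 'p \<Rightarrow> real^2) \<Rightarrow> (real \<Rightarrow> 'c \<Rightarrow> state)
    \<Rightarrow> (real \<Rightarrow> 'p \<Rightarrow> real) \<Rightarrow> ('c \<Rightarrow> real) \<Rightarrow> bool" where
  "periodic_flow M I x U e m \<longleftrightarrow>
     (\<forall>t\<in>I. (\<Union>c\<in>cells M. triangle M (x t) c) = UNIV) \<and>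
     (\<exists>L1 L2. cross2 L1 L2 \<noteq> 0 \<and>
        translation_symmetry M I x U e m L1 \<and> translation_symmetry M I x U e m L2)"

end

theory Submission
  imports Defs
begin

text \<open>On a triangle the discrete gradient is the exact gradient of the affine interpolant, so it
  maps an edge vector to the difference of the nodal values. The distortion equation thus reads
  \<open>A' = - A ** grad v\<close>, and \<open>A *v (x q - x p)\<close> is constant in time along every edge of the cell;
  initially it is the edge vector itself. The corner vector is half the rotated opposite edge, so
  its cross product with a row of \<open>A\<close> is half a component of the initial edge vector from \<open>p\<^sup>+\<close> to
  \<open>p\<^sup>-\<close>, and the sum of these over a closed fan telescopes. In the periodic case the fan is closed
  because the triangles cover a neighbourhood of the midpoint of each edge at \<open>p\<close>.\<close>

section \<open>Cells and areas\<close>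

lemma card_verts:
  assumes "conforming_mesh M x" "c \<in> cells M"
  shows "card (verts M c) = 3"
  using assms unfolding conforming_mesh_def connectivity_def by blast

text \<open>The vertices form a single 3-cycle: \<open>pplus M c q\<close> is a vertex of the cell
  other than \<open>q\<close> and \<open>pminus M c q = r\<close>, which leaves only
  \<open>p\<close>.\<close>

lemma conforming_mesh_cell:
  assumes M: "conforming_mesh M x" and c: "c \<in> cells M" and p: "p \<in> verts M c"
  defines "q \<equiv> pminus M c p" and "r \<equiv> pplus M c p"
  shows "verts M c = {p, q, r}" "p \<noteq> q" "p \<noteq> r" "q \<noteq> r"
    and "pminus M c q = r" "pplus M c q = p" "pminus M c r = p" "pplus M c r = q"
    and "0 < cross2 (x q - x p) (x r - x p)"
proof -
  have V: "verts M c = {s, pminus M c s, pplus M c s}" if "s \<in> verts M c" for s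
    using M[unfolded conforming_mesh_def connectivity_def, THEN conjunct1, THEN bspec, OF c,
        THEN conjunct2, THEN bspec, OF that] .
  have dist: "s \<noteq> pminus M c s" "s \<noteq> pplus M c s" "pminus M c s \<noteq> pplus M c s"
    if "s \<in> verts M c" for s
  proof -
    have "card {s, pminus M c s, pplus M c s} = 3"
      using card_verts[OF M c] by (subst V[OF that, symmetric])
    then show "s \<noteq> pminus M c s" "s \<noteq> pplus M c s" "pminus M c s \<noteq> pplus M c s"
      by (auto simp: card_insert_if split: if_splits)
  qed
  show V1: "verts M c = {p, q, r}" and "p \<noteq> q" "p \<noteq> r" "q \<noteq> r"
    unfolding q_def r_def by (fact V[OF p] dist[OF p])+
  have q: "q \<in> verts M c" unfolding V1 by simp
  show q1: "pminus M c q = r" by (simp add: q_def r_def pminus_def pplus_def)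
  have "pplus M c q \<in> {p, q, r}" unfolding V1[symmetric] by (subst V[OF q]) simp
  then show q2: "pplus M c q = p"
    using dist(2,3)[OF q] q1 by auto
  then show r1: "pminus M c r = p"
    by (simp add: q_def r_def pminus_def pplus_def)
  show "pplus M c r = q"
    using r1 by (simp add: q_def pminus_def pplus_def)
  show "0 < cross2 (x q - x p) (x r - x p)"
    using M[unfolded conforming_mesh_def, THEN conjunct2, THEN conjunct1, THEN bspec, OF c, THEN bspec, OF p]
    unfolding q_def r_def .
qed

text \<open>Counter-clockwise orientation removes the absolute value from the determinant formula
  for the area.\<close>

lemma area_eq_cross2:
  assumes M: "conforming_mesh M x" and c: "c \<in> cells M" and p: "p \<in> verts M c"
  shows "area M x c = cross2 (x (pminus M c p) - x p) (x (pplus M c p) - x p) / 2"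
proof -
  note T = conforming_mesh_cell[OF M c p]
  show ?thesis
    unfolding area_def triangle_def T(1) image_insert image_empty content_triangle
    using T(9) by (simp add: cross2_def algebra_simps abs_if)
qed

lemma area_pos:
  assumes "conforming_mesh M x" "c \<in> cells M"
  shows "0 < area M x c"
proof -
  obtain p where p: "p \<in> verts M c"
    using card_verts[OF assms] by (metis card.empty ex_in_conv zero_neq_numeral)
  show ?thesis
    using area_eq_cross2[OF assms p] conforming_mesh_cell(9)[OF assms p] by simp
qed

lemma finite_cells_at:
  assumes M: "conforming_mesh M x"
  shows "finite (cells_at M p)"
proof (rule finite_subset)
  show "cells_at M p \<subseteq> {c \<in> cells M. triangle M x c \<inter> {x p} \<noteq> {}}"
    by (auto simp: cells_at_def triangle_def hull_inc)
  show "finite {c \<in> cells M. triangle M x c \<inter> {x p} \<noteq> {}}"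
    using M unfolding conforming_mesh_def by (meson bounded_insert bounded_empty)
qed

section \<open>The discrete gradient\<close>

text \<open>Corner vectors are half the rotated sides, and the sides of a triangle form a closed
  polygon.\<close>

lemma sum_corner:
  assumes M: "conforming_mesh M x" and c: "c \<in> cells M"
  shows "(\<Sum>p\<in>verts M c. corner M x p c) = 0"
proof -
  obtain p where p: "p \<in> verts M c"
    using card_verts[OF assms] by (metis card.empty ex_in_conv zero_neq_numeral)
  note T = conforming_mesh_cell[OF M c p]
  show ?thesis
    using T(2-4) by (simp add: T(1) corner_def T(5-8) vec_eq_iff forall_2 field_simps)
qed

lemma disc_grad_vec_edge:
  assumes M: "conforming_mesh M x" and c: "c \<in> cells M"
    and p: "p \<in> verts M c" and s: "s \<in> verts M c"
  shows "disc_grad_vec M x c \<phi> *v (x s - x p) = \<phi> s - \<phi> p"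
proof -
  define q where "q = pminus M c p"
  define r where "r = pplus M c p"
  note T = conforming_mesh_cell[OF M c p, folded q_def r_def]
  define a where "a = area M x c"
  have a: "a = cross2 (x q - x p) (x r - x p) / 2" and a0: "a \<noteq> 0"
    using area_eq_cross2[OF M c p] area_pos[OF M c] by (simp_all add: a_def q_def r_def)
  have G: "(disc_grad_vec M x c \<phi> *v w) $ i =
      (\<phi> p $ i * (corner M x p c \<bullet> w) + \<phi> q $ i * (corner M x q c \<bullet> w)
        + \<phi> r $ i * (corner M x r c \<bullet> w)) / a" for i w
    using T(2-4)
    by (simp add: disc_grad_vec_def disc_grad_def matrix_vector_mult_def sum_2 T(1) inner_vec_def
        a_def[symmetric] add_divide_distrib algebra_simps)
  \<comment> \<open>These values express that each corner vector divided by \<open>a\<close> is the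
    gradient of the barycentric coordinate of its vertex.\<close>
  have C: "corner M x p c \<bullet> (x q - x p) = - a" "corner M x q c \<bullet> (x q - x p) = a"
    "corner M x r c \<bullet> (x q - x p) = 0" "corner M x p c \<bullet> (x r - x p) = - a"
    "corner M x q c \<bullet> (x r - x p) = 0" "corner M x r c \<bullet> (x r - x p) = a"
    unfolding a by (simp_all add: corner_def T(5-8) q_def[symmetric] r_def[symmetric] cross2_def
        inner_vec_def sum_2 field_simps)
  consider "s = p" | "s = q" | "s = r" using s T(1) by blast
  then show ?thesis
    using a0 by cases (simp_all add: vec_eq_iff G C diff_divide_distrib)
qed

text \<open>Because the corner vectors sum to zero, the cell velocity drops out; dividing by the
  mass then leaves the discrete gradient of the nodal velocity.\<close>

lemma balance_dstn_disc_grad_vec: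
  assumes M: "conforming_mesh M x" and c: "c \<in> cells M"
    and tau: "0 < tau (U c)" and m: "m = dens (U c) * area M x c"
    and d: "balance_dstn W 0 M x U c m d"
  shows "d = - (dstn (U c) ** disc_grad_vec M x c (nvel M x U))"
proof -
  have rho: "dens (U c) \<noteq> 0" using tau by (simp add: dens_def)
  have a: "area M x c \<noteq> 0" using area_pos[OF M c] by simp
  have K: "(\<Sum>p\<in>verts M c. corner M x p c $ k * (nvel M x U p $ l - vel (U c) $ l)) =
     area M x c * disc_grad_vec M x c (nvel M x U) $ l $ k" for k l
  proof -
    have "(\<Sum>p\<in>verts M c. corner M x p c $ k) = 0"
      using arg_cong[OF sum_corner[OF M c], of "\<lambda>v. v $ k"] by simp
    then have "(\<Sum>p\<in>verts M c. corner M x p c $ k * vel (U c) $ l) = 0"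
      by (simp flip: sum_distrib_right)
    then show ?thesis
      using a by (simp add: disc_grad_vec_def disc_grad_def right_diff_distrib sum_subtractf mult.commute)
  qed
  have "d $ i $ k = - (dstn (U c) ** disc_grad_vec M x c (nvel M x U)) $ i $ k" for i k
  proof -
    have "(dens (U c) * area M x c) *
       (d $ i $ k + (\<Sum>l\<in>UNIV. dstn (U c) $ i $ l * disc_grad_vec M x c (nvel M x U) $ l $ k)) = 0"
      using d[unfolded balance_dstn_def K m] by (simp add: sum_2 algebra_simps)
    then show ?thesis using rho a by (simp add: matrix_matrix_mult_def)
  qed
  then show ?thesis by (simp add: vec_eq_iff)
qed

section \<open>Transport of edge vectors\<close>

text \<open>Supplies the product rule for a time-dependent matrix acting on a moving edge
  vector.\<close>

lemma bounded_bilinear_matrix_vector_mult: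
  "bounded_bilinear ((*v) :: real^'n^'m \<Rightarrow> real^'n \<Rightarrow> real^'m)"
  unfolding bilinear_conv_bounded_bilinear[symmetric] bilinear_def
  by (auto intro!: linearI simp: matrix_vector_right_distrib matrix_vector_mult_add_rdistrib
      matrix_vector_mult_scaleR scaleR_matrix_vector_assoc)

lemma dstn_edge_const:
  fixes U :: "real \<Rightarrow> 'c \<Rightarrow> state"
  assumes S: "htc_solution W 0 M I x U e m" and I: "is_interval I" "0 \<in> I"
    and t: "t \<in> I" and c: "c \<in> cells M" and p: "p \<in> verts M c" and q: "q \<in> verts M c"
  shows "dstn (U t c) *v (x t q - x t p) = dstn (U 0 c) *v (x 0 q - x 0 p)"
proof -
  let ?w = "\<lambda>s. dstn (U s c) *v (x s q - x s p)"
  have nodes: "p \<in> nodes M" "q \<in> nodes M" using c p q by (auto simp: nodes_def)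
  have deriv: "(?w has_vector_derivative 0) (at s within I)" if s: "s \<in> I" for s
  proof -
    let ?G = "disc_grad_vec M (x s) c (nvel M (x s) (U s))"
    note sol = S[unfolded htc_solution_def, THEN bspec, OF s]
    have M: "conforming_mesh M (x s)" using sol by (rule conjunct1)
    have dx: "((\<lambda>s. x s z) has_vector_derivative nvel M (x s) (U s) z) (at s within I)"
      if "z \<in> nodes M" for z
      using sol[THEN conjunct2, THEN conjunct1, THEN bspec, OF that] by (rule conjunct2)
    note cell = sol[THEN conjunct2, THEN conjunct2, THEN bspec, OF c]
    have tau: "0 < tau (U s c)" "m c = dens (U s c) * area M (x s) c"
      using cell[THEN conjunct1] cell[THEN conjunct2, THEN conjunct2, THEN conjunct1] .
    have "\<exists>d. ((\<lambda>s. dstn (U s c)) has_vector_derivative d) (at s within I) \<and>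
        balance_dstn W 0 M (x s) (U s) c (m c) d"
      using cell by (elim conjE)
    then obtain d where dA: "((\<lambda>s. dstn (U s c)) has_vector_derivative d) (at s within I)"
      and bal: "balance_dstn W 0 M (x s) (U s) c (m c) d"
      by blast
    have d: "d = - (dstn (U s c) ** ?G)"
      using M c tau bal by (rule balance_dstn_disc_grad_vec)
    have "(?w has_vector_derivative
        dstn (U s c) *v (nvel M (x s) (U s) q - nvel M (x s) (U s) p)
        + d *v (x s q - x s p)) (at s within I)"
      using bounded_bilinear.has_vector_derivative[OF bounded_bilinear_matrix_vector_mult dA
          has_vector_derivative_diff[OF dx[OF nodes(2)] dx[OF nodes(1)]]] .
    \<comment> \<open>The discrete gradient turns the edge vector into the difference of nodal
      velocities, so the two terms of the product rule cancel.\<close>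
    moreover have "d *v (x s q - x s p) =
        - (dstn (U s c) *v (nvel M (x s) (U s) q - nvel M (x s) (U s) p))"
    proof -
      have "d *v (x s q - x s p) = - ((dstn (U s c) ** ?G) *v (x s q - x s p))"
        unfolding d by (simp add: vec_eq_iff matrix_vector_mult_def sum_negf)
      then show ?thesis
        by (simp add: disc_grad_vec_edge[OF M c p q] flip: matrix_vector_mul_assoc)
    qed
    ultimately show ?thesis by simp
  qed
  \<comment> \<open>An interval is convex, so a derivative within \<open>I\<close> that vanishes
    throughout forces a constant.\<close>
  obtain w where "\<And>s. s \<in> I \<Longrightarrow> ?w s = w"
    using has_vector_derivative_zero_constant[OF is_interval_convex[OF I(1)] deriv] by blast
  then show ?thesis using t I(2) by simp
qed

text \<open>The quarter turn in the corner vector converts the cross product into an inner product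
  with half the opposite side.\<close>

lemma cross2_corner_row:
  "cross2 (corner M x p c) (A $ i) = (A *v (x (pminus M c p) - x (pplus M c p))) $ i / 2"
  by (simp add: cross2_def corner_def matrix_vector_mult_def sum_2 algebra_simps
      diff_divide_distrib add_divide_distrib)

section \<open>Closed fans\<close>

lemma collinear_imp_cross2_0:
  assumes "collinear {a, b, u}"
  shows "cross2 (b - a) (u - a) = 0"
proof (cases "a = b")
  case False
  then obtain s t where "s + t = 1" "u = s *\<^sub>R a + t *\<^sub>R b"
    using assms unfolding collinear_3_affine_hull[OF False] affine_hull_2 by blast
  moreover from this have "s = 1 - t" by simp
  ultimately have "u - a = t *\<^sub>R (b - a)" by (simp add: algebra_simps)
  then show ?thesis by (simp add: cross2_def)
qed (simp add: cross2_def)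

text \<open>A point slightly off the midpoint of the common edge, on the side of both apexes, is
  interior to both triangles.\<close>

lemma triangles_common_edge_overlap:
  fixes a b u v :: "real^2"
  assumes u: "0 < cross2 (b - a) (u - a)" and v: "0 < cross2 (b - a) (v - a)"
  shows "interior (convex hull {a, b, u}) \<inter> interior (convex hull {a, b, v}) \<noteq> {}"
proof -
  have 2: "DIM(real^2) = 2" by simp
  note int_u = interior_convex_hull_3_minimal[of a b u, OF _ 2]
  note int_v = interior_convex_hull_3_minimal[of a b v, OF _ 2]
  have nc: "\<not> collinear {a, b, u}" "\<not> collinear {a, b, v}"
    using u v collinear_imp_cross2_0 by force+
  \<comment> \<open>The ratio of the heights of \<open>u\<close> and \<open>v\<close> over the
    common edge; with it \<open>h\<close> becomes parallel to that edge, and \<alpha> is the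
    resulting coefficient.\<close>
  define \<gamma> where "\<gamma> = cross2 (b - a) (u - a) / cross2 (b - a) (v - a)"
  define h where "h = u - a - \<gamma> *\<^sub>R (v - a)"
  define n where "n = (b - a) \<bullet> (b - a)"
  define \<alpha> where "\<alpha> = ((b - a) \<bullet> h) / n"
  have \<gamma>: "0 < \<gamma>" using u v by (simp add: \<gamma>_def)
  have n: "n \<noteq> 0" using u by (auto simp: n_def cross2_def)
  have "cross2 (b - a) h = cross2 (b - a) (u - a) - \<gamma> * cross2 (b - a) (v - a)"
    by (simp add: h_def cross2_def algebra_simps)
  also have "\<dots> = 0" using v by (simp add: \<gamma>_def)
  finally have cr: "cross2 (b - a) h = 0" .
  \<comment> \<open>In the plane, a vector minus its projection onto \<open>b - a\<close> is a
    multiple of the rotated \<open>b - a\<close>, with the cross product as factor.\<close>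
  have "n *\<^sub>R h = ((b - a) \<bullet> h) *\<^sub>R (b - a)"
  proof -
    have "(n *\<^sub>R h - ((b - a) \<bullet> h) *\<^sub>R (b - a)) $ 1 = - (b - a) $ 2 * cross2 (b - a) h"
      "(n *\<^sub>R h - ((b - a) \<bullet> h) *\<^sub>R (b - a)) $ 2 = (b - a) $ 1 * cross2 (b - a) h"
      by (simp_all add: n_def cross2_def inner_vec_def sum_2 algebra_simps)
    then show ?thesis using cr by (simp add: vec_eq_iff forall_2)
  qed
  then have "h = \<alpha> *\<^sub>R (b - a)"
    using n by (metis \<alpha>_def scaleR_cancel_left scaleR_scaleR nonzero_mult_div_cancel_left
        times_divide_eq_right)
  then have uv: "u = a + \<gamma> *\<^sub>R (v - a) + \<alpha> *\<^sub>R (b - a)"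
    by (simp add: h_def algebra_simps)
  \<comment> \<open>Small enough that the coordinates of \<open>w\<close> with respect to
    \<open>a\<close>, \<open>b\<close>, \<open>v\<close> stay positive, whatever the sign of
    \<alpha>.\<close>
  define \<epsilon> where "\<epsilon> = 1 / (2 * \<bar>\<alpha>\<bar> + 2 * \<gamma> + 3)"
  have \<epsilon>: "0 < \<epsilon>" "\<epsilon> < 1/2" using \<gamma> by (auto simp: \<epsilon>_def field_simps)
  have \<epsilon>1: "\<epsilon> * (2 * \<bar>\<alpha>\<bar> + 2 * \<gamma> + 3) = 1" using \<gamma> by (simp add: \<epsilon>_def)
  define w where "w = ((1 - \<epsilon>)/2) *\<^sub>R a + ((1 - \<epsilon>)/2) *\<^sub>R b + \<epsilon> *\<^sub>R u"
  have "w \<in> interior (convex hull {a, b, u})"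
    unfolding int_u[OF nc(1)] w_def
    by (rule CollectI, rule exI[of _ "(1 - \<epsilon>)/2"], rule exI[of _ "(1 - \<epsilon>)/2"], rule exI[of _ \<epsilon>])
       (use \<epsilon> in simp)
  moreover have "w \<in> interior (convex hull {a, b, v})"
  proof -
    have w: "w = ((1 + \<epsilon>)/2 - \<epsilon> * \<gamma> - \<epsilon> * \<alpha>) *\<^sub>R a + ((1 - \<epsilon>)/2 + \<epsilon> * \<alpha>) *\<^sub>R b + (\<epsilon> * \<gamma>) *\<^sub>R v"
      unfolding w_def uv by (simp add: vec_eq_iff field_simps)
    have "2 * (\<epsilon> * \<bar>\<alpha>\<bar>) + 2 * (\<epsilon> * \<gamma>) + 3 * \<epsilon> = 1" using \<epsilon>1 by (simp add: algebra_simps)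
    moreover have "\<epsilon> * \<alpha> \<le> \<epsilon> * \<bar>\<alpha>\<bar>" "- (\<epsilon> * \<bar>\<alpha>\<bar>) \<le> \<epsilon> * \<alpha>"
      using \<epsilon> abs_le_iff[of "\<epsilon> * \<alpha>" "\<epsilon> * \<bar>\<alpha>\<bar>"] by (auto simp: abs_mult)
    moreover have "0 < \<epsilon> * \<gamma>" using \<epsilon> \<gamma> by simp
    \<comment> \<open>With the products \<open>\<epsilon> * \<bar>\<alpha>\<bar>\<close>,
      \<open>\<epsilon> * \<gamma>\<close>, \<open>\<epsilon> * \<alpha>\<close> abstracted to X, Y,
      Z, the claim is linear arithmetic.\<close>
    moreover have "0 < (1 + \<epsilon>)/2 - Y - Z \<and> 0 < (1 - \<epsilon>)/2 + Z"
      if "2 * X + 2 * Y + 3 * \<epsilon> = 1" "Z \<le> X" "- X \<le> Z" "0 < Y" for X Y Z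
      using that \<epsilon> by (simp add: field_simps)
    ultimately have "0 < (1 + \<epsilon>)/2 - \<epsilon> * \<gamma> - \<epsilon> * \<alpha>" "0 < (1 - \<epsilon>)/2 + \<epsilon> * \<alpha>" "0 < \<epsilon> * \<gamma>"
      by metis+
    moreover have "((1 + \<epsilon>)/2 - \<epsilon> * \<gamma> - \<epsilon> * \<alpha>) + ((1 - \<epsilon>)/2 + \<epsilon> * \<alpha>) + \<epsilon> * \<gamma> = 1"
      by (simp add: field_simps)
    ultimately show ?thesis unfolding int_v[OF nc(2)] w by blast
  qed
  ultimately show ?thesis by blast
qed

text \<open>Two such cells would share an edge and, by their common orientation, lie on the same
  side of it, so their interiors would meet.\<close>

lemma inj_on_pminus:
  assumes M: "conforming_mesh M x"
  shows "inj_on (\<lambda>c. pminus M c p) (cells_at M p)"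
proof (rule inj_onI, rule ccontr)
  fix c d assume c: "c \<in> cells_at M p" and d: "d \<in> cells_at M p"
    and eq: "pminus M c p = pminus M d p" and ne: "c \<noteq> d"
  have cd: "c \<in> cells M" "p \<in> verts M c" "d \<in> cells M" "p \<in> verts M d"
    using c d by (auto simp: cells_at_def)
  note C = conforming_mesh_cell[OF M cd(1,2)] and D = conforming_mesh_cell[OF M cd(3,4)]
  have "interior (triangle M x c) \<inter> interior (triangle M x d) \<noteq> {}"
    unfolding triangle_def C(1) D(1) image_insert image_empty eq
    by (rule triangles_common_edge_overlap) (use C(9) D(9) eq in auto)
  then show False using M cd ne unfolding conforming_mesh_def by blast
qed

text \<open>Seen from the other end of the edge, \<open>p\<close> is the following vertex, which
  reduces the claim to the previous lemma.\<close>

lemma inj_on_pplus: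
  assumes M: "conforming_mesh M x"
  shows "inj_on (\<lambda>c. pplus M c p) (cells_at M p)"
proof (rule inj_onI)
  fix c d assume c: "c \<in> cells_at M p" and d: "d \<in> cells_at M p"
    and eq: "pplus M c p = pplus M d p"
  have cd: "c \<in> cells M" "p \<in> verts M c" "d \<in> cells M" "p \<in> verts M d"
    using c d by (auto simp: cells_at_def)
  note C = conforming_mesh_cell[OF M cd(1,2)] and D = conforming_mesh_cell[OF M cd(3,4)]
  have "c \<in> cells_at M (pplus M c p)" "d \<in> cells_at M (pplus M c p)"
    using cd C(1) D(1) eq by (auto simp: cells_at_def)
  moreover have "pminus M c (pplus M c p) = pminus M d (pplus M c p)"
    using C(7) D(7) eq by simp
  ultimately show "c = d" using inj_on_pminus[OF M] by (auto dest: inj_onD)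
qed

text \<open>The cell \<open>d\<close> is found by approaching the midpoint of the edge from outside of \<open>c\<close>: by local
  finiteness and closedness of the triangles, a cell other than \<open>c\<close> contains this midpoint.\<close>

lemma covering_next_cell:
  assumes M: "conforming_mesh M x" and cov: "(\<Union>c\<in>cells M. triangle M x c) = UNIV"
    and c: "c \<in> cells_at M p"
  shows "\<exists>d\<in>cells_at M p. pminus M d p = pplus M c p"
proof -
  have cc: "c \<in> cells M" "p \<in> verts M c" using c by (auto simp: cells_at_def)
  define r where "r = pminus M c p"
  define q where "q = pplus M c p"
  note C = conforming_mesh_cell[OF M cc, folded r_def q_def]
  define z where "z = (1/2) *\<^sub>R x p + (1/2) *\<^sub>R x q"
  \<comment> \<open>The ray from the midpoint \<open>z\<close> that leads straight away from the
    opposite vertex \<open>x r\<close>.\<close>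
  define y where "y = (\<lambda>\<delta>. z + \<delta> *\<^sub>R (z - x r))"
  \<comment> \<open>The ball contains \<open>y \<delta>\<close> for 0 < \<delta> < 1, so only
    finitely many cells are relevant and their union is closed.\<close>
  define N where "N = {d \<in> cells M. triangle M x d \<inter> cball z (norm (z - x r)) \<noteq> {}} - {c}"
  define F where "F = (\<Union>d\<in>N. triangle M x d)"
  have "finite N"
    using M unfolding N_def conforming_mesh_def by (simp add: bounded_cball)
  moreover have "finite (verts M d)" if "d \<in> cells M" for d
    using card_verts[OF M that] by (metis card.infinite zero_neq_numeral)
  ultimately have "closed F"
    unfolding F_def triangle_def N_def
    by (intro closed_UN ballI compact_imp_closed finite_imp_compact_convex_hull) auto
  have yF: "y \<delta> \<in> F" if "0 < \<delta>" "\<delta> < 1" for \<delta>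
  proof -
    \<comment> \<open>The barycentric coordinate of \<open>y \<delta>\<close> at \<open>x r\<close>
      would be \<open>- \<delta>\<close>: it is 0 at \<open>z\<close> and decreases along the
      ray.\<close>
    have "y \<delta> \<notin> triangle M x c"
    proof
      assume "y \<delta> \<in> triangle M x c"
      then obtain u v w where uvw: "0 \<le> u" "0 \<le> v" "0 \<le> w" "u + v + w = 1"
        and yd: "y \<delta> = u *\<^sub>R x p + v *\<^sub>R x r + w *\<^sub>R x q"
        unfolding triangle_def C(1) image_insert image_empty convex_hull_3 by blast
      have u: "u = 1 - v - w" using uvw(4) by simp
      have eq: "y \<delta> - x p = v *\<^sub>R (x r - x p) + w *\<^sub>R (x q - x p)"
        unfolding yd u by (simp add: algebra_simps)
      have "cross2 (y \<delta> - x p) (x q - x p) = v * cross2 (x r - x p) (x q - x p)"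
        unfolding eq by (simp add: cross2_def algebra_simps)
      moreover have "cross2 (y \<delta> - x p) (x q - x p) = - \<delta> * cross2 (x r - x p) (x q - x p)"
        by (simp add: y_def z_def cross2_def field_simps)
      ultimately have "v * cross2 (x r - x p) (x q - x p) = - \<delta> * cross2 (x r - x p) (x q - x p)"
        by simp
      then have "v = - \<delta>" using mult_right_cancel[OF less_imp_neq[OF C(9), symmetric]] by blast
      then show False using uvw that by simp
    qed
    moreover have "y \<delta> \<in> cball z (norm (z - x r))"
      using that by (simp add: y_def dist_norm mult_left_le_one_le)
    moreover obtain d where "d \<in> cells M" "y \<delta> \<in> triangle M x d" using cov by blast
    ultimately show ?thesis unfolding F_def N_def by blast
  qed
  have "(y \<longlongrightarrow> y 0) (at_right 0)"
    unfolding y_def by (intro tendsto_intros)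
  moreover have "eventually (\<lambda>\<delta>. y \<delta> \<in> F) (at_right 0)"
    using yF eventually_at_right_real[of 0 1] by (auto elim!: eventually_mono)
  ultimately have "y 0 \<in> F"
    using Lim_in_closed_set[OF \<open>closed F\<close>] by (metis trivial_limit_at_right_real)
  then obtain d where d: "d \<in> cells M" "d \<noteq> c" and zd: "z \<in> triangle M x d"
    by (auto simp: F_def N_def y_def)
  have "z \<in> triangle M x c"
    unfolding triangle_def C(1) image_insert image_empty convex_hull_3 z_def
    by (rule CollectI, rule exI[of _ "1/2"], rule exI[of _ 0], rule exI[of _ "1/2"]) simp
  moreover have "triangle M x c \<inter> triangle M x d = convex hull (x ` (verts M c \<inter> verts M d))"
    using M cc(1) d unfolding conforming_mesh_def by metis
  ultimately have zcap: "z \<in> convex hull (x ` (verts M c \<inter> verts M d))"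
    using zd by (metis IntI)
  \<comment> \<open>Were \<open>p\<close> not shared, conformity would put \<open>z\<close> on the
    side from \<open>x r\<close> to \<open>x q\<close>, which misses the midpoint of the side from
    \<open>x p\<close> to \<open>x q\<close>. The argument for \<open>q\<close> is
    symmetric.\<close>
  have pd: "p \<in> verts M d"
  proof (rule ccontr)
    assume "p \<notin> verts M d"
    then have "z \<in> convex hull {x r, x q}"
      using zcap hull_mono[of "x ` (verts M c \<inter> verts M d)" "{x r, x q}" convex] C(1) by auto
    then obtain u v where "u + v = 1" "z = u *\<^sub>R x r + v *\<^sub>R x q"
      unfolding convex_hull_2 by blast
    moreover from this have v: "v = 1 - u" by simp
    ultimately have "z - x q = u *\<^sub>R (x r - x q)" unfolding v by (simp add: algebra_simps)
    then have "cross2 (z - x q) (x r - x q) = 0" by (simp add: cross2_def)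
    moreover have "cross2 (z - x q) (x r - x q) = cross2 (x p - x q) (x r - x q) / 2"
      by (simp add: z_def cross2_def field_simps)
    moreover have "cross2 (x p - x q) (x r - x q) = cross2 (x r - x p) (x q - x p)"
      by (simp add: cross2_def algebra_simps)
    ultimately show False using C(9) by simp
  qed
  have qd: "q \<in> verts M d"
  proof (rule ccontr)
    assume "q \<notin> verts M d"
    then have "z \<in> convex hull {x r, x p}"
      using zcap hull_mono[of "x ` (verts M c \<inter> verts M d)" "{x r, x p}" convex] C(1) by auto
    then obtain u v where "u + v = 1" "z = u *\<^sub>R x r + v *\<^sub>R x p"
      unfolding convex_hull_2 by blast
    moreover from this have v: "v = 1 - u" by simp
    ultimately have "z - x p = u *\<^sub>R (x r - x p)" unfolding v by (simp add: algebra_simps)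
    then have "cross2 (x r - x p) (z - x p) = 0" by (simp add: cross2_def)
    moreover have "cross2 (x r - x p) (z - x p) = cross2 (x r - x p) (x q - x p) / 2"
      by (simp add: z_def cross2_def field_simps)
    ultimately show False using C(9) by simp
  qed
  have "d \<in> cells_at M p" using d pd by (simp add: cells_at_def)
  \<comment> \<open>Distinct cells at \<open>p\<close> have distinct \<open>pplus\<close>, so
    \<open>q\<close>, being a vertex of \<open>d\<close> other than \<open>p\<close>, can only be
    its \<open>pminus\<close>.\<close>
  moreover have "q \<noteq> pplus M d p"
    using inj_on_pplus[OF M, of p] c d \<open>d \<in> cells_at M p\<close> unfolding q_def by (auto dest: inj_onD)
  then have "pminus M d p = q"
    using conforming_mesh_cell(1)[OF M d(1) pd] qd C(3) by auto
  ultimately show ?thesis using q_def by blast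
qed

section \<open>Closed fans at interior nodes and the telescoping sum\<close>

lemma interior_node_next_cell:
  assumes "interior_node M p" "c \<in> cells_at M p"
  shows "\<exists>d\<in>cells_at M p. pminus M d p = pplus M c p"
proof -
  obtain cs where cs: "cs \<noteq> []" "set cs = cells_at M p"
    "\<And>i. i < length cs \<Longrightarrow> pplus M (cs ! i) p = pminus M (cs ! (Suc i mod length cs)) p"
    using assms(1) unfolding interior_node_def by blast
  then obtain i where "i < length cs" "cs ! i = c" using assms(2) by (metis in_set_conv_nth)
  moreover have "cs ! (Suc i mod length cs) \<in> cells_at M p"
    using cs(1,2) by (metis length_greater_0_conv mod_less_divisor nth_mem)
  ultimately show ?thesis using cs(3) by metis
qed

text \<open>Closedness embeds the set of all \<open>pplus\<close> in the set of all
  \<open>pminus\<close>. Both are injective images of the same finite set of cells, so they coincide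
  and both sums run over one set of nodes.\<close>

lemma sum_pminus_eq_sum_pplus:
  fixes f :: "'p \<Rightarrow> 'b::comm_monoid_add"
  assumes M: "conforming_mesh M x"
    and closed: "\<And>c. c \<in> cells_at M p \<Longrightarrow> \<exists>d\<in>cells_at M p. pminus M d p = pplus M c p"
  shows "(\<Sum>c\<in>cells_at M p. f (pminus M c p)) = (\<Sum>c\<in>cells_at M p. f (pplus M c p))"
proof -
  let ?C = "cells_at M p"
  have "(\<lambda>c. pplus M c p) ` ?C \<subseteq> (\<lambda>c. pminus M c p) ` ?C"
    using closed by (metis (no_types, lifting) image_eqI image_subsetI)
  then have "(\<lambda>c. pplus M c p) ` ?C = (\<lambda>c. pminus M c p) ` ?C"
    using finite_cells_at[OF M] card_image[OF inj_on_pminus[OF M]] card_image[OF inj_on_pplus[OF M]]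
    by (metis card_subset_eq finite_imageI)
  then show ?thesis
    using sum.reindex[OF inj_on_pminus[OF M], of f p] sum.reindex[OF inj_on_pplus[OF M], of f p]
    by (simp add: o_def)
qed

section \<open>Preservation of the curl at closed fans\<close>

theorem theorem3p4:
  fixes M :: "('p, 'c) mesh"
    and W :: material
    and I :: "real set"
    and x :: "real \<Rightarrow> 'p \<Rightarrow> real^2"
    and U :: "real \<Rightarrow> 'c \<Rightarrow> state"
    and e :: "real \<Rightarrow> 'p \<Rightarrow> real"
    and m :: "'c \<Rightarrow> real"
  assumes "admissible_material W"
    and "is_interval I" and "0 \<in> I" and "I \<subseteq> {0..}"
    and "htc_solution W 0 M I x U e m"
    and "\<forall>c\<in>cells M. dstn (U 0 c) = disc_grad_vec M (x 0) c (\<lambda>p. x 0 p)"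
  shows "\<forall>t\<in>I. \<forall>p\<in>nodes M. interior_node M p \<or> periodic_flow M I x U e m \<longrightarrow>
           disc_curl_rows M (x t) p (\<lambda>c. dstn (U t c)) = 0"
proof (intro ballI impI)
  fix t p assume t: "t \<in> I" and fan: "interior_node M p \<or> periodic_flow M I x U e m"
  have conf: "conforming_mesh M (x s)" if "s \<in> I" for s
    using assms(5) that unfolding htc_solution_def by blast
  note M0 = conf[OF assms(3)]
  \<comment> \<open>Closedness concerns only the fixed connectivity, so in the periodic case the
    covering at time 0 suffices for all times.\<close>
  have closed: "\<exists>d\<in>cells_at M p. pminus M d p = pplus M c p" if "c \<in> cells_at M p" for c
    using fan interior_node_next_cell[OF _ that] covering_next_cell[OF M0 _ that] assms(3)
    unfolding periodic_flow_def by blast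
  have edge: "dstn (U t c) *v (x t (pminus M c p) - x t (pplus M c p)) =
      x 0 (pminus M c p) - x 0 (pplus M c p)" if "c \<in> cells_at M p" for c
  proof -
    have c: "c \<in> cells M" "p \<in> verts M c" using that by (auto simp: cells_at_def)
    have v: "pminus M c p \<in> verts M c" "pplus M c p \<in> verts M c"
      using conforming_mesh_cell(1)[OF M0 c] by auto
    \<comment> \<open>At time 0 the distortion is the discrete gradient of the node positions, which
      maps each edge vector to itself.\<close>
    show ?thesis
      using dstn_edge_const[OF assms(5,2,3) t c(1) v(2,1)] disc_grad_vec_edge[OF M0 c(1) v(2,1)]
        assms(6) c(1) by simp
  qed
  have "(\<Sum>c\<in>cells_at M p. cross2 (corner M (x t) p c) (dstn (U t c) $ i)) = 0" for i
  proof -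
    have "(\<Sum>c\<in>cells_at M p. cross2 (corner M (x t) p c) (dstn (U t c) $ i)) =
        (\<Sum>c\<in>cells_at M p. (x 0 (pminus M c p) - x 0 (pplus M c p)) $ i / 2)"
      by (rule sum.cong) (simp_all only: cross2_corner_row edge)
    also have "\<dots> = 0"
      using sum_pminus_eq_sum_pplus[OF M0 closed, of "\<lambda>q. x 0 q $ i / 2"]
      by (simp add: diff_divide_distrib sum_subtractf)
    finally show ?thesis .
  qed
  then show "disc_curl_rows M (x t) p (\<lambda>c. dstn (U t c)) = 0"
    by (simp add: disc_curl_rows_def disc_curl_def vec_eq_iff)
qed

end
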